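(* Let $D$ be finite, $X\subseteq D^m$ non-degenerate, $t=m$, $\tau=(1,\dots,m)$, and let the range of type $j$ be $D_j=\mathrm{pr}_jX$. Then $X$ is an impossibility domain with respect to IIA + Idempotency + Non-dictatorship if and only if (i) for every $1\le k,\ell\le m$, $u\in D_k$, $v\in D_\ell$, the relation $R^{u,v}_{k,\ell}$ is expressible by a multi-sorted $(X,\tau)^+$-gadget, and (ii) for every $j$ with $|D_j|=2$, the multi-sorted not-all-equal relation $\mathrm{NAE}_{j,j,j}$ is expressible by a multi-sorted $(X,\tau)^+$-gadget. The analogous statement holds with "Idempotency" replaced by "Supportiveness" and $(X,\tau)^+$ replaced by $(X,\tau)^{\mho}$.
   Context: For $X\subseteq D^m$, IIA aggregators of arity $n$ are $f=(f_1,\dots,f_m)$, $f_j:D_j^n\to D_j$, such that coordinatewise application to any $n$ elements of $X$ yields an element of $X$; idempotent: $f_j(u,\dots,u)=u$; supportive: $f_j(u_1,\dots,u_n)\in\{u_1,\dots,u_n\}$; dictatorship: some $k$ with $f_j(u_1,\dots,u_n)=u_k$ for all $j$. $X$ is an impossibility domain (w.r.t. IIA + Idempotency/Supportiveness + Non-dictatorship) if for no $n\ge2$ there is an idempotent/supportive non-dictatorial IIA aggregator of arity $n$. Non-degenerate: $|D_j|>1$ for all $j$. Multi-sorted setting with types $[t]$ and ranges $D_b$: a multi-sorted relation $(R,\sigma)$ has a type sequence $\sigma$ and $R\subseteq\prod_iD_{\sigma_i}$. A multi-sorted $\Gamma$-gadget is an expression $\exists y_1,\dots,y_{k'}:\bigwedge_i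 R_i(\dots)$ over typed variables, each atom being a member of $\Gamma$ or an equality $(x=y,(b,b))$, with consistent typing; it defines the relation of value tuples of the free variables $x_1,\dots,x_k$ for which witnessing values of the $y$'s exist. $(X,\tau)^+$ is the set consisting of $(X,\tau)$ and all assignment relations $(x=v,(a))$ with $a\in[t]$, $v\in D_a$; $(X,\tau)^{\mho}$ consists of $(X,\tau)$ and all unary relations $(x\in A,(a))$ with $A\subseteq D_a$. $R^{u,v}_{k,\ell}$ is the relation with type sequence $(k,\ell)$ given by $\{(x,y)\in D_k\times D_\ell:\neg(x=u\wedge y=v)\}$. For $|D_j|=2$, $\mathrm{NAE}_{j,j,j}$ is the relation with type sequence $(j,j,j)$ given by $\{(x,y,z)\in D_j^3: |\{x,y,z\}|>1\}$. *)

theory Defs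
  imports Main
begin

text \<open>
  Issues and types are numbered from \<open>0\<close>: the index set \<open>[m]\<close> is \<open>{..<m}\<close>, and the type
  sequence \<open>(1, \<dots>, m)\<close> is \<open>[0..<m]\<close>. A tuple in \<open>D\<^sup>m\<close> is a list of length \<open>m\<close>.
\<close>

definition power_tuples :: "'a set \<Rightarrow> nat \<Rightarrow> 'a list set" where
  "power_tuples D m = {xs. length xs = m \<and> set xs \<subseteq> D}"

definition pr :: "'a list set \<Rightarrow> nat \<Rightarrow> 'a set" where
  "pr X j = (\<lambda>x. x ! j) ` X"

definition nondegenerate :: "nat \<Rightarrow> 'a list set \<Rightarrow> bool" where
  "nondegenerate m X \<longleftrightarrow> (\<forall>j<m. card (pr X j) > 1)"

text \<open>
  The component \<open>f j\<close> of an aggregator is a total function on lists; only its values on lists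
  in \<open>power_tuples (pr X j) n\<close> are ever constrained or used.
\<close>

definition iia_aggregator ::
    "nat \<Rightarrow> 'a list set \<Rightarrow> nat \<Rightarrow> (nat \<Rightarrow> 'a list \<Rightarrow> 'a) \<Rightarrow> bool" where
  "iia_aggregator m X n f \<longleftrightarrow>
     (\<forall>j<m. \<forall>us\<in>power_tuples (pr X j) n. f j us \<in> pr X j) \<and>
     (\<forall>xs\<in>power_tuples X n. map (\<lambda>j. f j (map (\<lambda>x. x ! j) xs)) [0..<m] \<in> X)"

definition idempotent ::
    "nat \<Rightarrow> 'a list set \<Rightarrow> nat \<Rightarrow> (nat \<Rightarrow> 'a list \<Rightarrow> 'a) \<Rightarrow> bool" where
  "idempotent m X n f \<longleftrightarrow> (\<forall>j<m. \<forall>u\<in>pr X j. f j (replicate n u) = u)"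

definition supportive ::
    "nat \<Rightarrow> 'a list set \<Rightarrow> nat \<Rightarrow> (nat \<Rightarrow> 'a list \<Rightarrow> 'a) \<Rightarrow> bool" where
  "supportive m X n f \<longleftrightarrow> (\<forall>j<m. \<forall>us\<in>power_tuples (pr X j) n. f j us \<in> set us)"

definition dictatorship ::
    "nat \<Rightarrow> 'a list set \<Rightarrow> nat \<Rightarrow> (nat \<Rightarrow> 'a list \<Rightarrow> 'a) \<Rightarrow> bool" where
  "dictatorship m X n f \<longleftrightarrow>
     (\<exists>k<n. \<forall>j<m. \<forall>us\<in>power_tuples (pr X j) n. f j us = us ! k)"

text \<open>The parameter \<open>P\<close> is \<open>idempotent\<close> or \<open>supportive\<close>.\<close>

definition impossibility_domain ::
    "(nat \<Rightarrow> 'a list set \<Rightarrow> nat \<Rightarrow> (nat \<Rightarrow> 'a list \<Rightarrow> 'a) \<Rightarrow> bool) \<Rightarrow> nat \<Rightarrow> 'a list set \<Rightarrow> bool"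
    where
  "impossibility_domain P m X \<longleftrightarrow>
     \<not> (\<exists>n\<ge>2. \<exists>f. iia_aggregator m X n f \<and> P m X n f \<and> \<not> dictatorship m X n f)"

text \<open>
  A multi-sorted relation is a pair of a type sequence and a set of tuples; \<open>D b\<close> is the range of
  type \<open>b\<close>.
\<close>

type_synonym 'a msrel = "nat list \<times> 'a list set"

definition typed_tuples :: "(nat \<Rightarrow> 'a set) \<Rightarrow> nat list \<Rightarrow> 'a list set" where
  "typed_tuples D \<sigma> = {xs. length xs = length \<sigma> \<and> (\<forall>i<length \<sigma>. xs ! i \<in> D (\<sigma> ! i))}"

definition eq_rel :: "(nat \<Rightarrow> 'a set) \<Rightarrow> nat \<Rightarrow> 'a msrel" where
  "eq_rel D b = ([b, b], {[x, y] | x y. x \<in> D b \<and> y \<in> D b \<and> x = y})"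

text \<open>
  The variables of a gadget are numbered consecutively, first the free ones and then the
  existentially quantified ones, so variable \<open>v\<close> has type
  \<open>(free_types g @ bound_types g) ! v\<close>. An atom is a relation together with the list of variables
  it is applied to.
\<close>

datatype 'a gadget =
  Gadget (free_types: "nat list") (bound_types: "nat list")
    (atoms: "('a msrel \<times> nat list) list")

definition is_gadget ::
    "nat \<Rightarrow> (nat \<Rightarrow> 'a set) \<Rightarrow> 'a msrel set \<Rightarrow> 'a gadget \<Rightarrow> bool" where
  "is_gadget t D \<Gamma> g \<longleftrightarrow>
     (let \<rho> = free_types g @ bound_types g in
       set \<rho> \<subseteq> {..<t} \<and>
       (\<forall>((\<sigma>, R), vs)\<in>set (atoms g).
          (\<sigma>, R) \<in> \<Gamma> \<union> eq_rel D ` {..<t} \<and>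
          set vs \<subseteq> {..<length \<rho>} \<and> map (\<lambda>v. \<rho> ! v) vs = \<sigma>))"

definition gadget_rel :: "(nat \<Rightarrow> 'a set) \<Rightarrow> 'a gadget \<Rightarrow> 'a msrel" where
  "gadget_rel D g =
     (free_types g,
      {xs \<in> typed_tuples D (free_types g).
         \<exists>ys\<in>typed_tuples D (bound_types g).
           \<forall>((\<sigma>, R), vs)\<in>set (atoms g). map (\<lambda>v. (xs @ ys) ! v) vs \<in> R})"

definition expressible ::
    "nat \<Rightarrow> (nat \<Rightarrow> 'a set) \<Rightarrow> 'a msrel set \<Rightarrow> 'a msrel \<Rightarrow> bool" where
  "expressible t D \<Gamma> Q \<longleftrightarrow> (\<exists>g. is_gadget t D \<Gamma> g \<and> gadget_rel D g = Q)"

definition with_assignments ::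
    "nat \<Rightarrow> (nat \<Rightarrow> 'a set) \<Rightarrow> 'a msrel \<Rightarrow> 'a msrel set" where
  "with_assignments t D Q = insert Q {([a], {[v]}) | a v. a < t \<and> v \<in> D a}"

definition with_unaries ::
    "nat \<Rightarrow> (nat \<Rightarrow> 'a set) \<Rightarrow> 'a msrel \<Rightarrow> 'a msrel set" where
  "with_unaries t D Q = insert Q {([a], {[x] | x. x \<in> A}) | a A. a < t \<and> A \<subseteq> D a}"

definition excl_rel ::
    "(nat \<Rightarrow> 'a set) \<Rightarrow> nat \<Rightarrow> nat \<Rightarrow> 'a \<Rightarrow> 'a \<Rightarrow> 'a msrel" where
  "excl_rel D k l u v =
     ([k, l], {[x, y] | x y. x \<in> D k \<and> y \<in> D l \<and> \<not> (x = u \<and> y = v)})"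

definition NAE_rel :: "(nat \<Rightarrow> 'a set) \<Rightarrow> nat \<Rightarrow> 'a msrel" where
  "NAE_rel D j =
     ([j, j, j], {[x, y, z] | x y z. x \<in> D j \<and> y \<in> D j \<and> z \<in> D j \<and> card {x, y, z} > 1})"

end

theory Submission
  imports Defs
begin

text \<open>
  By the multi-sorted Geiger/Bodnarchuk--Kaluzhnin--Kotov--Romov correspondence, a nonempty relation
  is expressible from a finite language iff it is preserved by all polymorphisms of that language;
  the gadget for the nontrivial direction takes the indicator structure of arity \<open>N\<close>, whose
  variables are the pairs \<open>(j, us)\<close> with \<open>us \<in> (D j)\<^sup>N\<close> and whose solutions are exactly the \<open>N\<close>-ary
  polymorphisms. The polymorphisms of \<open>X\<close> with all assignments (all unary relations) are the
  idempotent (supportive) aggregators. Dictatorships preserve every relation, which gives one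
  implication.

  For the converse, call a coalition \<open>A\<close> winning if it is the set of voters agreeing with some
  outcome of some \<open>f j\<close>. Preservation of the relations \<open>R\<close> says that any two winning coalitions
  meet, so exactly one of \<open>A\<close> and its complement is winning. An issue with three values, or else
  the not-all-equal relation, yields closure under intersection. The winning coalitions then form
  an ultrafilter on a finite set, and its generator is the dictator.
\<close>

section \<open>Tuples over a set and finiteness of tuple spaces\<close>

lemma power_tuples_nth_mem: "us \<in> power_tuples A n \<Longrightarrow> i < n \<Longrightarrow> us ! i \<in> A"
  by (auto simp: power_tuples_def)

lemma map_power_tuples:
  "rs \<in> power_tuples R n \<Longrightarrow> (\<And>r. r \<in> R \<Longrightarrow> h r \<in> A) \<Longrightarrow> map h rs \<in> power_tuples A n"
  by (auto simp: power_tuples_def)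

lemma map_upt_power_tuples:
  "(\<And>i. i < n \<Longrightarrow> h i \<in> A) \<Longrightarrow> map h [0..<n] \<in> power_tuples A n"
  by (auto simp: power_tuples_def)

lemma finite_power_tuples: "finite A \<Longrightarrow> finite (power_tuples A n)"
  unfolding power_tuples_def using finite_lists_length_eq[of A n] by (simp add: conj_commute)

lemma finite_typed_tuples:
  assumes "\<And>j. j \<in> set \<sigma> \<Longrightarrow> finite (D j)"
  shows "finite (typed_tuples D \<sigma>)"
proof (rule finite_subset)
  show "typed_tuples D \<sigma> \<subseteq> power_tuples (\<Union>j\<in>set \<sigma>. D j) (length \<sigma>)"
    by (fastforce simp: typed_tuples_def power_tuples_def in_set_conv_nth)
  show "finite (power_tuples (\<Union>j\<in>set \<sigma>. D j) (length \<sigma>))"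
    using assms by (intro finite_power_tuples) auto
qed

section \<open>Polymorphisms and expressibility\<close>

text \<open>The rows \<open>rs\<close> form a matrix whose column \<open>i\<close> goes to the
  operation of its type \<open>\<sigma> ! i\<close>, so columns of equal type share one
  operation.\<close>

definition preserves :: "nat \<Rightarrow> (nat \<Rightarrow> 'a list \<Rightarrow> 'a) \<Rightarrow> 'a msrel \<Rightarrow> bool" where
  "preserves n f = (\<lambda>(\<sigma>, R). \<forall>rs\<in>power_tuples R n.
     map (\<lambda>i. f (\<sigma> ! i) (map (\<lambda>r. r ! i) rs)) [0..<length \<sigma>] \<in> R)"

text \<open>Closure of the ranges is a separate clause; it makes the equality relations, which every
  gadget may use, preserved as well.\<close>

definition polymorphism ::
    "nat \<Rightarrow> (nat \<Rightarrow> 'a set) \<Rightarrow> 'a msrel set \<Rightarrow> nat \<Rightarrow> (nat \<Rightarrow> 'a list \<Rightarrow> 'a) \<Rightarrow> bool" where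
  "polymorphism t D \<Gamma> n f \<longleftrightarrow>
     (\<forall>j<t. \<forall>us\<in>power_tuples (D j) n. f j us \<in> D j) \<and> (\<forall>Q\<in>\<Gamma>. preserves n f Q)"

definition well_typed :: "nat \<Rightarrow> (nat \<Rightarrow> 'a set) \<Rightarrow> 'a msrel \<Rightarrow> bool" where
  "well_typed t D = (\<lambda>(\<sigma>, R). set \<sigma> \<subseteq> {..<t} \<and> R \<subseteq> typed_tuples D \<sigma>)"

lemma preservesD:
  "preserves n f (\<sigma>, R) \<Longrightarrow> rs \<in> power_tuples R n \<Longrightarrow>
     map (\<lambda>i. f (\<sigma> ! i) (map (\<lambda>r. r ! i) rs)) [0..<length \<sigma>] \<in> R"
  by (auto simp: preserves_def)

text \<open>The two columns of a matrix of equality rows coincide, so the same operation is applied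
  twice to the same list.\<close>

lemma preserves_eq_rel:
  assumes "\<And>us. us \<in> power_tuples (D b) n \<Longrightarrow> f b us \<in> D b"
  shows "preserves n f (eq_rel D b)"
proof -
  have "[f b (map (\<lambda>r. r ! 0) rs), f b (map (\<lambda>r. r ! 1) rs)] \<in> snd (eq_rel D b)"
    if rs: "rs \<in> power_tuples (snd (eq_rel D b)) n" for rs
  proof -
    have "map (\<lambda>r. r ! 1) rs \<in> power_tuples (D b) n"
      by (rule map_power_tuples[OF rs]) (auto simp: eq_rel_def)
    moreover have eq: "map (\<lambda>r. r ! 0) rs = map (\<lambda>r. r ! 1) rs"
      using rs by (fastforce simp: power_tuples_def eq_rel_def)
    ultimately show ?thesis
      using assms unfolding eq by (simp add: eq_rel_def)
  qed
  then show ?thesis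
    by (auto simp: preserves_def eq_rel_def upt_rec)
qed

text \<open>Applying \<open>f\<close> to the rows extended by their witnesses gives an assignment of
  all variables. Each atom holds for it because \<open>f\<close> preserves the relation of that
  atom.\<close>

lemma preserves_gadget_rel:
  assumes poly: "polymorphism t D \<Gamma> n f" and g: "is_gadget t D \<Gamma> g"
  shows "preserves n f (gadget_rel D g)"
proof -
  define \<phi> \<beta> where "\<phi> = free_types g" and "\<beta> = bound_types g"
  define sat where "sat = (\<lambda>zs. \<forall>((\<sigma>, R), vs)\<in>set (atoms g). map (\<lambda>v. zs ! v) vs \<in> R)"
  define R where "R = {xs \<in> typed_tuples D \<phi>. \<exists>ys\<in>typed_tuples D \<beta>. sat (xs @ ys)}"
  have rel: "gadget_rel D g = (\<phi>, R)"
    by (simp add: gadget_rel_def R_def \<phi>_def \<beta>_def sat_def)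
  have types: "set (\<phi> @ \<beta>) \<subseteq> {..<t}"
    using g by (simp add: is_gadget_def \<phi>_def \<beta>_def Let_def)
  have closed: "f j us \<in> D j" if "j < t" "us \<in> power_tuples (D j) n" for j us
    using poly that by (simp add: polymorphism_def)
  have typed: "map (\<lambda>i. f (\<sigma> ! i) (map (\<lambda>r. r ! i) rs)) [0..<length \<sigma>] \<in> typed_tuples D \<sigma>"
    if "rs \<in> power_tuples (typed_tuples D \<sigma>) n" "set \<sigma> \<subseteq> {..<t}" for \<sigma> rs
    using that by (auto simp: typed_tuples_def intro!: closed map_power_tuples dest: nth_mem)
  have "\<forall>r\<in>R. \<exists>ys. ys \<in> typed_tuples D \<beta> \<and> sat (r @ ys)"
    by (auto simp: R_def)
  then obtain w where w: "w r \<in> typed_tuples D \<beta>" "sat (r @ w r)" if "r \<in> R" for r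
    by metis
  show ?thesis
    unfolding rel preserves_def split
  proof
    fix rs assume rs: "rs \<in> power_tuples R n"
    let ?xs = "map (\<lambda>i. f (\<phi> ! i) (map (\<lambda>r. r ! i) rs)) [0..<length \<phi>]"
    let ?ys = "map (\<lambda>i. f (\<beta> ! i) (map (\<lambda>r. r ! i) (map w rs))) [0..<length \<beta>]"
    have rs_typed: "rs \<in> power_tuples (typed_tuples D \<phi>) n"
      using rs by (auto simp: power_tuples_def R_def)
    have xs: "?xs \<in> typed_tuples D \<phi>"
      using types by (intro typed rs_typed) auto
    have ys: "?ys \<in> typed_tuples D \<beta>"
      using types by (intro typed map_power_tuples[OF rs] w) auto
    have len: "length r = length \<phi>" if "r \<in> set rs" for r
      using that rs_typed by (auto simp: power_tuples_def typed_tuples_def)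
    \<comment> \<open>Free and bound variables now behave alike: each takes the value of
      \<open>f\<close>, at its own type, on the column of that variable.\<close>
    have lookup: "(?xs @ ?ys) ! v = f ((\<phi> @ \<beta>) ! v) (map (\<lambda>r. (r @ w r) ! v) rs)"
      if "v < length (\<phi> @ \<beta>)" for v
    proof (cases "v < length \<phi>")
      case True
      then show ?thesis
        using len by (auto simp: nth_append intro!: arg_cong[where f = "f _"])
    next
      case False
      with that have "v - length \<phi> < length \<beta>" by simp
      with False show ?thesis
        using len by (auto simp: nth_append intro!: arg_cong[where f = "f _"])
    qed
    have "map (\<lambda>v. (?xs @ ?ys) ! v) vs \<in> S" if atom: "((\<sigma>, S), vs) \<in> set (atoms g)" for \<sigma> S vs
    proof -
      from g atom have mem: "(\<sigma>, S) \<in> \<Gamma> \<union> eq_rel D ` {..<t}"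
        and vs: "set vs \<subseteq> {..<length (\<phi> @ \<beta>)}" and \<sigma>: "map (\<lambda>v. (\<phi> @ \<beta>) ! v) vs = \<sigma>"
        by (auto simp: is_gadget_def Let_def \<phi>_def \<beta>_def)
      have "preserves n f (\<sigma>, S)"
        using mem
      proof
        assume "(\<sigma>, S) \<in> \<Gamma>"
        then show ?thesis using poly by (simp add: polymorphism_def)
      next
        assume "(\<sigma>, S) \<in> eq_rel D ` {..<t}"
        then obtain b where "b < t" "(\<sigma>, S) = eq_rel D b" by auto
        then show ?thesis using preserves_eq_rel[of D b n f] closed by simp
      qed
      moreover have "map (\<lambda>r. map (\<lambda>v. (r @ w r) ! v) vs) rs \<in> power_tuples S n"
      proof (rule map_power_tuples[OF rs])
        show "map (\<lambda>v. (r @ w r) ! v) vs \<in> S" if "r \<in> R" for r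
          using bspec[OF w(2)[OF that, unfolded sat_def] atom] by simp
      qed
      ultimately have "map (\<lambda>i. f (\<sigma> ! i) (map (\<lambda>r. r ! i)
          (map (\<lambda>r. map (\<lambda>v. (r @ w r) ! v) vs) rs))) [0..<length \<sigma>] \<in> S"
        by (rule preservesD)
      also have "map (\<lambda>i. f (\<sigma> ! i) (map (\<lambda>r. r ! i)
          (map (\<lambda>r. map (\<lambda>v. (r @ w r) ! v) vs) rs))) [0..<length \<sigma>] = map (\<lambda>v. (?xs @ ?ys) ! v) vs"
      proof (rule nth_equalityI)
        show "length (map (\<lambda>i. f (\<sigma> ! i) (map (\<lambda>r. r ! i)
          (map (\<lambda>r. map (\<lambda>v. (r @ w r) ! v) vs) rs))) [0..<length \<sigma>])
          = length (map (\<lambda>v. (?xs @ ?ys) ! v) vs)"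
          using \<sigma> by auto
      next
        fix i assume "i < length (map (\<lambda>i. f (\<sigma> ! i) (map (\<lambda>r. r ! i)
          (map (\<lambda>r. map (\<lambda>v. (r @ w r) ! v) vs) rs))) [0..<length \<sigma>])"
        then have i: "i < length \<sigma>" "i < length vs"
          using \<sigma> by auto
        moreover have "\<sigma> ! i = (\<phi> @ \<beta>) ! (vs ! i)"
          using i \<sigma> by auto
        moreover have "vs ! i < length (\<phi> @ \<beta>)"
          using vs i nth_mem by blast
        ultimately show "map (\<lambda>i. f (\<sigma> ! i) (map (\<lambda>r. r ! i)
          (map (\<lambda>r. map (\<lambda>v. (r @ w r) ! v) vs) rs))) [0..<length \<sigma>] ! i
          = map (\<lambda>v. (?xs @ ?ys) ! v) vs ! i"
          using lookup by (simp add: comp_def)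
      qed
      finally show ?thesis .
    qed
    then have "sat (?xs @ ?ys)"
      by (auto simp: sat_def)
    with xs ys show "?xs \<in> R"
      unfolding R_def by blast
  qed
qed

lemma expressible_imp_preserves:
  "polymorphism t D \<Gamma> n f \<Longrightarrow> expressible t D \<Gamma> Q \<Longrightarrow> preserves n f Q"
  using preserves_gadget_rel by (auto simp: expressible_def)

text \<open>The gadget is the indicator structure of arity \<open>length qs\<close>, with its free
  variables tied to the columns of the matrix \<open>qs\<close>. Bound values satisfying it are the
  table of a polymorphism, whose action on \<open>qs\<close> stays in \<open>set qs\<close> by
  \<open>pres\<close>. Conversely, the projection to place \<open>k\<close> is a solution and
  returns the row \<open>qs ! k\<close>.\<close>

lemma expressible_if_preserved:
  assumes finD: "\<And>j. j < t \<Longrightarrow> finite (D j)"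
    and fin\<Gamma>: "finite \<Gamma>" and typed\<Gamma>: "\<And>Q. Q \<in> \<Gamma> \<Longrightarrow> well_typed t D Q"
    and typed: "well_typed t D (\<sigma>, set qs)"
    and pres: "\<And>f. polymorphism t D \<Gamma> (length qs) f \<Longrightarrow> preserves (length qs) f (\<sigma>, set qs)"
  shows "expressible t D \<Gamma> (\<sigma>, set qs)"
proof -
  define N where "N = length qs"
  define V where "V = (SIGMA j:{..<t}. power_tuples (D j) N)"
  have "finite V"
    using finD by (auto simp: V_def intro: finite_power_tuples)
  then obtain vars where vars: "set vars = V"
    using finite_list by blast
  \<comment> \<open>The list \<open>vars\<close> may repeat pairs; \<open>idx\<close> fixes one
    position for each, and the atoms refer only to these positions.\<close>
  then have "\<forall>p\<in>V. \<exists>i<length vars. vars ! i = p"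
    by (metis in_set_conv_nth)
  then obtain idx where idx: "idx p < length vars" "vars ! idx p = p" if "p \<in> V" for p
    by metis
  define col where "col = (\<lambda>\<tau> rs i. (\<tau> ! i, map (\<lambda>r :: 'a list. r ! i) rs) :: nat \<times> 'a list)"
  have col_V: "col \<tau> rs i \<in> V"
    if "well_typed t D (\<tau>, R)" "rs \<in> power_tuples R N" "i < length \<tau>" for \<tau> R rs i
  proof -
    have "map (\<lambda>r. r ! i) rs \<in> power_tuples (D (\<tau> ! i)) N"
      using that(1,3) by (intro map_power_tuples[OF that(2)]) (auto simp: well_typed_def typed_tuples_def)
    moreover have "\<tau> ! i < t"
      using that(1,3) nth_mem by (fastforce simp: well_typed_def)
    ultimately show ?thesis by (simp add: V_def col_def)
  qed
  have qs: "qs \<in> power_tuples (set qs) N"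
    by (simp add: power_tuples_def N_def)
  define K where "K = length \<sigma>"
  define \<beta> where "\<beta> = map fst vars"
  \<comment> \<open>One atom for every relation of \<open>\<Gamma>\<close> and every choice of
    \<open>N\<close> of its rows: together they say that the table preserves
    \<open>\<Gamma>\<close>. The offset \<open>K\<close> skips the free variables.\<close>
  define A1 where "A1 = (\<lambda>(Q, rs). (Q, map (\<lambda>i. K + idx (col (fst Q) rs i)) [0..<length (fst Q)])) `
    (SIGMA Q:\<Gamma>. power_tuples (snd Q) N)"
  \<comment> \<open>These equalities identify free variable \<open>i\<close> with the table entry at
    column \<open>i\<close> of \<open>qs\<close>.\<close>
  define A2 where "A2 = (\<lambda>i. (eq_rel D (\<sigma> ! i), [i, K + idx (col \<sigma> qs i)])) ` {..<K}"
  have "finite (snd Q)" if "Q \<in> \<Gamma>" for Q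
  proof (rule finite_subset)
    show "snd Q \<subseteq> typed_tuples D (fst Q)" "finite (typed_tuples D (fst Q))"
      using typed\<Gamma>[OF that] by (auto simp: well_typed_def intro!: finite_typed_tuples finD)
  qed
  then have "finite (A1 \<union> A2)"
    using fin\<Gamma> by (auto simp: A1_def A2_def intro!: finite_imageI finite_SigmaI finite_power_tuples)
  then obtain as where as: "set as = A1 \<union> A2"
    using finite_list by blast
  define g where "g = Gadget \<sigma> \<beta> as"
  have \<sigma>: "\<sigma> ! i < t" if "i < K" for i
    using typed that nth_mem by (fastforce simp: well_typed_def K_def)
  have len\<beta>: "length \<beta> = length vars"
    by (simp add: \<beta>_def)
  have \<beta>_idx: "\<beta> ! idx p = fst p" if "p \<in> V" for p
    using idx[OF that] by (simp add: \<beta>_def)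
  have "is_gadget t D \<Gamma> g"
  proof -
    have "set (\<sigma> @ \<beta>) \<subseteq> {..<t}"
      using typed vars by (auto simp: well_typed_def \<beta>_def V_def)
    moreover have "(\<tau>, R) \<in> \<Gamma> \<union> eq_rel D ` {..<t} \<and>
        set vs \<subseteq> {..<length (\<sigma> @ \<beta>)} \<and> map (\<lambda>v. (\<sigma> @ \<beta>) ! v) vs = \<tau>"
      if "((\<tau>, R), vs) \<in> A1" for \<tau> R vs
    proof -
      from that obtain rs where Q: "(\<tau>, R) \<in> \<Gamma>" and rs: "rs \<in> power_tuples R N"
        and vs: "vs = map (\<lambda>i. K + idx (col \<tau> rs i)) [0..<length \<tau>]"
        by (auto simp: A1_def)
      have c: "col \<tau> rs i \<in> V" if "i < length \<tau>" for i
        using col_V typed\<Gamma>[OF Q] rs that by blast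
      show ?thesis
        using Q idx(1)[OF c] \<beta>_idx[OF c]
        by (auto simp: vs K_def len\<beta> nth_append col_def intro!: nth_equalityI)
    qed
    moreover have "(\<tau>, R) \<in> \<Gamma> \<union> eq_rel D ` {..<t} \<and>
        set vs \<subseteq> {..<length (\<sigma> @ \<beta>)} \<and> map (\<lambda>v. (\<sigma> @ \<beta>) ! v) vs = \<tau>"
      if "((\<tau>, R), vs) \<in> A2" for \<tau> R vs
    proof -
      from that obtain i where i: "i < K" and Q: "(\<tau>, R) = eq_rel D (\<sigma> ! i)"
        and vs: "vs = [i, K + idx (col \<sigma> qs i)]"
        by (auto simp: A2_def)
      have c: "col \<sigma> qs i \<in> V"
        using col_V typed qs i by (simp add: K_def)
      have \<tau>: "\<tau> = [\<sigma> ! i, \<sigma> ! i]"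
        using Q by (simp add: eq_rel_def)
      have "(\<tau>, R) \<in> eq_rel D ` {..<t}"
        using Q \<sigma>[OF i] by auto
      then show ?thesis
        using i idx(1)[OF c] \<beta>_idx[OF c]
        by (auto simp: vs \<tau> K_def len\<beta> nth_append col_def)
    qed
    ultimately show ?thesis
      by (fastforce simp: is_gadget_def Let_def g_def as)
  qed
  moreover have "gadget_rel D g = (\<sigma>, set qs)"
  proof -
    define sat where "sat = (\<lambda>zs. \<forall>((\<tau>, R), vs)\<in>A1 \<union> A2. map (\<lambda>v. zs ! v) vs \<in> R)"
    have rel: "gadget_rel D g =
        (\<sigma>, {xs \<in> typed_tuples D \<sigma>. \<exists>ys\<in>typed_tuples D \<beta>. sat (xs @ ys)})"
      by (simp add: gadget_rel_def g_def sat_def as)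
    have "xs \<in> set qs"
      if xs: "xs \<in> typed_tuples D \<sigma>" and ys: "ys \<in> typed_tuples D \<beta>" and sat: "sat (xs @ ys)" for xs ys
    proof -
      \<comment> \<open>The bound values are read as an operation table; values at pairs outside
        \<open>V\<close> are arbitrary and do not matter.\<close>
      define f where "f = (\<lambda>j us. ys ! idx (j, us))"
      have len: "length xs = K"
        using xs by (simp add: typed_tuples_def K_def)
      have "preserves N f Q" if Q: "Q \<in> \<Gamma>" for Q
      proof -
        have "map (\<lambda>i. f (fst Q ! i) (map (\<lambda>r. r ! i) rs)) [0..<length (fst Q)] \<in> snd Q"
          if rs: "rs \<in> power_tuples (snd Q) N" for rs
        proof -
          have "((fst Q, snd Q), map (\<lambda>i. K + idx (col (fst Q) rs i)) [0..<length (fst Q)]) \<in> A1 \<union> A2"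
            using Q rs by (force simp: A1_def)
          with sat have "map (\<lambda>v. (xs @ ys) ! v)
              (map (\<lambda>i. K + idx (col (fst Q) rs i)) [0..<length (fst Q)]) \<in> snd Q"
            unfolding sat_def by fast
          then show ?thesis
            by (simp add: comp_def nth_append len f_def col_def)
        qed
        then show ?thesis by (simp add: preserves_def split_beta)
      qed
      moreover have "f j us \<in> D j" if "j < t" "us \<in> power_tuples (D j) N" for j us
      proof -
        have "(j, us) \<in> V" using that by (simp add: V_def)
        then show ?thesis
          using ys idx \<beta>_idx by (fastforce simp: f_def typed_tuples_def len\<beta>)
      qed
      ultimately have "preserves N f (\<sigma>, set qs)"
        using pres by (simp add: polymorphism_def N_def)
      then have "map (\<lambda>i. f (\<sigma> ! i) (map (\<lambda>r. r ! i) qs)) [0..<length \<sigma>] \<in> set qs"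
        using qs by (rule preservesD)
      moreover have "xs ! i = f (\<sigma> ! i) (map (\<lambda>r. r ! i) qs)" if i: "i < K" for i
      proof -
        have "(eq_rel D (\<sigma> ! i), [i, K + idx (col \<sigma> qs i)]) \<in> A1 \<union> A2"
          using i by (auto simp: A2_def)
        from bspec[OF sat[unfolded sat_def] this]
        have "map (\<lambda>v. (xs @ ys) ! v) [i, K + idx (col \<sigma> qs i)] \<in> snd (eq_rel D (\<sigma> ! i))"
          by (simp add: eq_rel_def)
        then show ?thesis
          using i by (simp add: nth_append len eq_rel_def f_def col_def)
      qed
      then have "xs = map (\<lambda>i. f (\<sigma> ! i) (map (\<lambda>r. r ! i) qs)) [0..<length \<sigma>]"
        using len by (auto simp: K_def intro!: nth_equalityI)
      ultimately show ?thesis by simp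
    qed
    moreover have "xs \<in> typed_tuples D \<sigma> \<and> (\<exists>ys\<in>typed_tuples D \<beta>. sat (xs @ ys))"
      if mem: "xs \<in> set qs" for xs
    proof -
      have xs: "xs \<in> typed_tuples D \<sigma>"
        using typed mem by (auto simp: well_typed_def)
      then have len: "length xs = K"
        by (simp add: typed_tuples_def K_def)
      obtain k where k: "k < N" "xs = qs ! k"
        using mem by (auto simp: N_def in_set_conv_nth)
      \<comment> \<open>The table of the projection to place \<open>k\<close>; the atoms of
        \<open>A1\<close> then return row \<open>k\<close> of their matrices.\<close>
      define ys where "ys = map (\<lambda>p. snd p ! k) vars"
      have "snd (vars ! i) ! k \<in> D (fst (vars ! i))" if "i < length vars" for i
      proof -
        have "vars ! i \<in> V" using vars that nth_mem by blast
        then show ?thesis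
          using k by (auto simp: V_def mem_Times_iff split_beta intro: power_tuples_nth_mem)
      qed
      then have ys: "ys \<in> typed_tuples D \<beta>"
        by (simp add: typed_tuples_def ys_def \<beta>_def)
      have ys_idx: "ys ! idx p = snd p ! k" if "p \<in> V" for p
        using idx[OF that] by (simp add: ys_def)
      have "map (\<lambda>v. (xs @ ys) ! v) vs \<in> R" if "((\<tau>, R), vs) \<in> A1" for \<tau> R vs
      proof -
        from that obtain rs where Q: "(\<tau>, R) \<in> \<Gamma>" and rs: "rs \<in> power_tuples R N"
          and vs: "vs = map (\<lambda>i. K + idx (col \<tau> rs i)) [0..<length \<tau>]"
          by (auto simp: A1_def)
        have c: "col \<tau> rs i \<in> V" if "i < length \<tau>" for i
          using col_V typed\<Gamma>[OF Q] rs that by blast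
        have "rs ! k \<in> R" using rs k by (auto intro: power_tuples_nth_mem)
        moreover from this have "length (rs ! k) = length \<tau>"
          using typed\<Gamma>[OF Q] by (auto simp: well_typed_def typed_tuples_def)
        moreover have "length rs = N" using rs by (simp add: power_tuples_def)
        ultimately have "map (\<lambda>v. (xs @ ys) ! v) vs = rs ! k"
          using k(1) ys_idx[OF c] by (auto simp: vs nth_append len col_def intro!: nth_equalityI)
        with \<open>rs ! k \<in> R\<close> show ?thesis by simp
      qed
      moreover have "map (\<lambda>v. (xs @ ys) ! v) vs \<in> R" if "((\<tau>, R), vs) \<in> A2" for \<tau> R vs
      proof -
        from that obtain i where i: "i < K" and Q: "(\<tau>, R) = eq_rel D (\<sigma> ! i)"
          and vs: "vs = [i, K + idx (col \<sigma> qs i)]"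
          by (auto simp: A2_def)
        have "col \<sigma> qs i \<in> V"
          using col_V typed qs i by (simp add: K_def)
        then show ?thesis
          using i Q xs k(1) ys_idx
          by (auto simp: vs nth_append len col_def eq_rel_def typed_tuples_def K_def N_def k(2)[symmetric])
      qed
      ultimately have "sat (xs @ ys)"
        by (auto simp: sat_def)
      with xs ys show ?thesis by blast
    qed
    ultimately show ?thesis
      unfolding rel by blast
  qed
  ultimately show ?thesis
    by (auto simp: expressible_def)
qed

section \<open>Winning coalitions\<close>

lemma card_gt_1_other:
  assumes "card A > 1"
  shows "\<exists>x\<in>A. x \<noteq> u"
proof (rule ccontr)
  assume "\<not> ?thesis"
  then have "A \<subseteq> {u}" by blast
  then show False using assms card_mono[of "{u}" A] by simp
qed

text \<open>The forbidden pair consists of the two outcomes. If no voter cast exactly this pair, all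
  rows would lie in the relation while the row of outcomes does not. Hence two winning coalitions
  share a voter.\<close>

lemma preserves_excl_relD:
  assumes "preserves n f (excl_rel D k l (f k us) (f l vs))"
    and us: "us \<in> power_tuples (D k) n" and vs: "vs \<in> power_tuples (D l) n"
  shows "\<exists>i<n. us ! i = f k us \<and> vs ! i = f l vs"
proof (rule ccontr)
  assume none: "\<not> ?thesis"
  define rs where "rs = map (\<lambda>i. [us ! i, vs ! i]) [0..<n]"
  have len: "length us = n" "length vs = n"
    using us vs by (auto simp: power_tuples_def)
  have "rs \<in> power_tuples (snd (excl_rel D k l (f k us) (f l vs))) n"
    using none power_tuples_nth_mem[OF us] power_tuples_nth_mem[OF vs]
    unfolding rs_def by (intro map_upt_power_tuples) (auto simp: excl_rel_def)
  with assms(1) have "map (\<lambda>i. f ([k, l] ! i) (map (\<lambda>r. r ! i) rs)) [0..<length [k, l]]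
      \<in> snd (excl_rel D k l (f k us) (f l vs))"
    unfolding excl_rel_def snd_conv by (rule preservesD)
  moreover have "map (\<lambda>r. r ! 0) rs = us" "map (\<lambda>r. r ! 1) rs = vs"
    using len by (auto simp: rs_def intro!: nth_equalityI)
  ultimately show False
    by (simp add: excl_rel_def upt_rec)
qed

text \<open>Three equal outcomes violate not-all-equal, so some row of votes must already violate
  it.\<close>

lemma preserves_NAE_relD:
  assumes "preserves n f (NAE_rel D j)"
    and us: "us \<in> power_tuples (D j) n" and vs: "vs \<in> power_tuples (D j) n"
    and ws: "ws \<in> power_tuples (D j) n"
    and eq: "f j us = f j vs" "f j vs = f j ws"
  shows "\<exists>i<n. us ! i = vs ! i \<and> vs ! i = ws ! i"
proof (rule ccontr)
  assume none: "\<not> ?thesis"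
  define rs where "rs = map (\<lambda>i. [us ! i, vs ! i, ws ! i]) [0..<n]"
  have len: "length us = n" "length vs = n" "length ws = n"
    using us vs ws by (auto simp: power_tuples_def)
  have "card {us ! i, vs ! i, ws ! i} > 1" if "i < n" for i
  proof -
    have "\<not> (us ! i = vs ! i \<and> vs ! i = ws ! i)" using none that by blast
    then show ?thesis by (auto simp: card_insert_if)
  qed
  then have "rs \<in> power_tuples (snd (NAE_rel D j)) n"
    using power_tuples_nth_mem[OF us] power_tuples_nth_mem[OF vs] power_tuples_nth_mem[OF ws]
    unfolding rs_def by (intro map_upt_power_tuples) (auto simp: NAE_rel_def)
  with assms(1) have "map (\<lambda>i. f ([j, j, j] ! i) (map (\<lambda>r. r ! i) rs)) [0..<length [j, j, j]]
      \<in> snd (NAE_rel D j)"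
    unfolding NAE_rel_def snd_conv by (rule preservesD)
  moreover have "map (\<lambda>r. r ! 0) rs = us" "map (\<lambda>r. r ! 1) rs = vs" "map (\<lambda>r. r ! 2) rs = ws"
    using len by (auto simp: rs_def intro!: nth_equalityI)
  ultimately show False
    using eq by (simp add: NAE_rel_def upt_rec numeral_2_eq_2[symmetric])
qed

text \<open>Whether a coalition wins turns out to depend on neither the issue nor the values voted
  on. One family of coalitions thus governs all issues, and one voter dictates them all.\<close>

lemma dictator_if_preserves:
  assumes n: "n > 0"
    and closed: "\<And>j us. j < t \<Longrightarrow> us \<in> power_tuples (D j) n \<Longrightarrow> f j us \<in> D j"
    and card: "\<And>j. j < t \<Longrightarrow> card (D j) > 1"
    and excl: "\<And>k l u v. k < t \<Longrightarrow> l < t \<Longrightarrow> u \<in> D k \<Longrightarrow> v \<in> D l \<Longrightarrow>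
      preserves n f (excl_rel D k l u v)"
    and NAE: "\<And>j. j < t \<Longrightarrow> card (D j) = 2 \<Longrightarrow> preserves n f (NAE_rel D j)"
  shows "\<exists>k<n. \<forall>j<t. \<forall>us\<in>power_tuples (D j) n. f j us = us ! k"
proof (cases "t = 0")
  case True
  with n show ?thesis by auto
next
  case False
  then have t: "0 < t" by simp
  define agree where "agree = (\<lambda>j us. {i. i < n \<and> us ! i = f j us})"
  define win where "win = (\<lambda>A. \<exists>j<t. \<exists>us\<in>power_tuples (D j) n. A = agree j us)"
  have winI: "win (agree j us)" if "j < t" "us \<in> power_tuples (D j) n" for j us
    using that by (auto simp: win_def)
  have meet: "A \<inter> B \<noteq> {}" if "win A" "win B" for A B
  proof -
    from that obtain j us l vs where "j < t" "us \<in> power_tuples (D j) n" "A = agree j us"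
      "l < t" "vs \<in> power_tuples (D l) n" "B = agree l vs"
      by (auto simp: win_def)
    then show ?thesis
      using preserves_excl_relD[OF excl, of j l us vs] closed by (auto simp: agree_def)
  qed
  have win_sub: "A \<subseteq> {..<n}" if "win A" for A
    using that by (auto simp: win_def agree_def)
  define tup where "tup = (\<lambda>A (u::'a) v. map (\<lambda>i. if i \<in> A then u else v) [0..<n])"
  have tup: "tup A u v \<in> power_tuples (D j) n" if "u \<in> D j" "v \<in> D j" for A u v j
    using that by (auto simp: tup_def intro: map_upt_power_tuples)
  \<comment> \<open>A winning coalition meets itself, so every outcome is somebody's vote.\<close>
  have agree_ne: "agree j us \<noteq> {}" if "j < t" "us \<in> power_tuples (D j) n" for j us
    using meet[OF winI winI] that by blast
  \<comment> \<open>When \<open>A\<close> votes \<open>u\<close> and the others vote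
    \<open>v\<close>, the agreeing voters are \<open>A\<close> or its complement. These are
    disjoint, so at most one of them wins, and this decides the outcome for every issue and every
    pair of values.\<close>
  have f_tup: "f j (tup A u v) = (if win A then u else v)"
    and total: "win A \<or> win ({..<n} - A)"
    if j: "j < t" and uv: "u \<in> D j" "v \<in> D j" "u \<noteq> v" and A: "A \<subseteq> {..<n}" for j u v A
  proof -
    let ?us = "tup A u v"
    have us: "?us \<in> power_tuples (D j) n" using tup uv by blast
    have w: "win (agree j ?us)" by (rule winI[OF j us])
    have "f j ?us = u \<or> f j ?us = v"
      using agree_ne[OF j us] by (fastforce simp: agree_def tup_def split: if_splits)
    moreover have "agree j ?us = A" if "f j ?us = u"
      unfolding agree_def that using uv A by (auto simp: tup_def split: if_splits)
    moreover have "agree j ?us = {..<n} - A" if "f j ?us = v"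
      unfolding agree_def that using uv A by (auto simp: tup_def split: if_splits)
    ultimately have *: "f j ?us = u \<and> win A \<or> f j ?us = v \<and> win ({..<n} - A)"
      using w by metis
    then show "win A \<or> win ({..<n} - A)" by blast
    show "f j ?us = (if win A then u else v)"
      using * meet[of A "{..<n} - A"] by auto
  qed
  have two: "\<exists>u v. u \<in> D j \<and> v \<in> D j \<and> u \<noteq> v" if "j < t" for j
    using card_gt_1_other[OF card[OF that]] by metis
  \<comment> \<open>Winning does not mention an issue, so issue \<open>0\<close> alone can serve to
    prove closure under intersection.\<close>
  then obtain u0 v0 where uv0: "u0 \<in> D 0" "v0 \<in> D 0" "u0 \<noteq> v0"
    using t by blast
  note total0 = total[OF t uv0]
  have inter: "win (A \<inter> B)" if A: "win A" and B: "win B" for A B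
  proof (rule ccontr)
    assume AB: "\<not> win (A \<inter> B)"
    note sub = win_sub[OF A] win_sub[OF B]
    show False
    proof (cases "card (D 0) = 2")
      case True
      \<comment> \<open>No voter lies in all of \<open>A\<close>, \<open>B\<close>, \<open>C\<close>
        or outside all of them. Yet all three win, giving three profiles with outcome
        \<open>u0\<close>, which not-all-equal forbids.\<close>
      define C where "C = {..<n} - (A \<inter> B)"
      have C: "win C"
        using total0[of "A \<inter> B"] AB sub by (auto simp: C_def)
      have "f 0 (tup E u0 v0) = u0" if "win E" for E
        using f_tup[OF t uv0 win_sub] that by simp
      then obtain i where "i < n" "tup A u0 v0 ! i = tup B u0 v0 ! i" "tup B u0 v0 ! i = tup C u0 v0 ! i"
        using preserves_NAE_relD[OF NAE[OF t True] tup tup tup] uv0 A B C by metis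
      then show False
        using uv0(3) by (auto simp: tup_def C_def split: if_splits)
    next
      case False
      then have "card (D 0 - {u0, v0}) \<noteq> 0"
        using card[OF t] uv0 by (simp add: card_Diff_subset)
      then obtain w0 where w0: "w0 \<in> D 0" "w0 \<noteq> u0" "w0 \<noteq> v0"
        by (metis Diff_iff card.empty ex_in_conv insertCI)
      \<comment> \<open>With a third value, the voters agreeing with the outcome are
        \<open>A \<inter> B\<close> for \<open>u0\<close>, miss \<open>B\<close> for
        \<open>v0\<close>, and miss \<open>A\<close> for \<open>w0\<close>. The last two cases
        contradict \<open>meet\<close>.\<close>
      define us where
        "us = map (\<lambda>i. if i \<in> A then if i \<in> B then u0 else v0 else w0) [0..<n]"
      have us: "us \<in> power_tuples (D 0) n"
        using uv0 w0 by (auto simp: us_def intro: map_upt_power_tuples)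
      have w: "win (agree 0 us)" by (rule winI[OF t us])
      have "agree 0 us = A \<inter> B \<or> agree 0 us \<inter> B = {} \<or> agree 0 us \<inter> A = {}"
        using uv0 w0 sub unfolding agree_def us_def by (auto split: if_splits)
      then show False
        using AB w meet A B by metis
    qed
  qed
  \<comment> \<open>A smallest winning coalition contains the generator of the ultrafilter: were
    \<open>{k}\<close> losing, its complement would win and cut \<open>K\<close> down to a smaller
    winning coalition.\<close>
  obtain K where K: "win K" and min: "\<And>A. win A \<Longrightarrow> card K \<le> card A"
    using ex_has_least_nat[of win _ card] winI[OF t tup[OF uv0(1,2)]] by metis
  obtain k where k: "k \<in> K" using meet[OF K K] by auto
  have kn: "k < n" using k win_sub[OF K] by auto
  have "win {k}"
  proof (rule ccontr)
    assume "\<not> win {k}"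
    then have "win ({..<n} - {k})"
      using total0[of "{k}"] kn by auto
    with K have "win (K \<inter> ({..<n} - {k}))" by (rule inter)
    then have "card K \<le> card (K \<inter> ({..<n} - {k}))" by (rule min)
    moreover have "card (K \<inter> ({..<n} - {k})) < card K"
      using k win_sub[OF K] by (intro psubset_card_mono) (auto intro: finite_subset)
    ultimately show False by simp
  qed
  \<comment> \<open>The coalition agreeing with any outcome meets \<open>{k}\<close>, so it contains
    \<open>k\<close>.\<close>
  have "f j us = us ! k" if "j < t" "us \<in> power_tuples (D j) n" for j us
    using meet[OF winI[OF that] \<open>win {k}\<close>] by (auto simp: agree_def)
  with kn show ?thesis by blast
qed

section \<open>Impossibility domains\<close>

text \<open>
  The parameter \<open>\<U>\<close> treats both cases at once: \<open>\<U> a\<close> consists of the singletons for assignments and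
  of all subsets of \<open>D a\<close> for unary relations.
\<close>

definition with_family ::
    "nat \<Rightarrow> (nat \<Rightarrow> 'a set set) \<Rightarrow> 'a msrel \<Rightarrow> 'a msrel set" where
  "with_family t \<U> Q = insert Q {([a], (\<lambda>x. [x]) ` A) | a A. a < t \<and> A \<in> \<U> a}"

lemma with_assignments_eq:
  "with_assignments t D Q = with_family t (\<lambda>a. (\<lambda>v. {v}) ` D a) Q"
  unfolding with_assignments_def with_family_def by (rule arg_cong[where f = "insert Q"]) auto

lemma with_unaries_eq: "with_unaries t D Q = with_family t (\<lambda>a. Pow (D a)) Q"
  by (simp add: with_unaries_def with_family_def setcompr_eq_image)

lemma preserves_unary:
  "preserves n f ([a], (\<lambda>x. [x]) ` A) \<longleftrightarrow> (\<forall>us\<in>power_tuples A n. f a us \<in> A)"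
proof -
  have "power_tuples ((\<lambda>x. [x]) ` A) n = map (\<lambda>x. [x]) ` power_tuples A n"
  proof
    show "power_tuples ((\<lambda>x. [x]) ` A) n \<subseteq> map (\<lambda>x. [x]) ` power_tuples A n"
    proof
      fix rs assume rs: "rs \<in> power_tuples ((\<lambda>x. [x]) ` A) n"
      then have "rs = map (\<lambda>x. [x]) (map hd rs)"
        by (auto simp: power_tuples_def comp_def intro!: map_idI[symmetric])
      moreover have "map hd rs \<in> power_tuples A n"
        by (rule map_power_tuples[OF rs]) auto
      ultimately show "rs \<in> map (\<lambda>x. [x]) ` power_tuples A n" by blast
    qed
  qed (auto intro: map_power_tuples)
  then show ?thesis
    by (auto simp: preserves_def comp_def)
qed

text \<open>For the type sequence \<open>[0..<m]\<close>, column \<open>j\<close> goes to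
  \<open>f j\<close>, so preserving \<open>X\<close> is the aggregator condition; the unary
  relations add closure of the sets in \<open>\<U>\<close>.\<close>

lemma polymorphism_with_family_iff:
  "polymorphism m (pr X) (with_family m \<U> ([0..<m], X)) n f \<longleftrightarrow>
     iia_aggregator m X n f \<and> (\<forall>j<m. \<forall>A\<in>\<U> j. \<forall>us\<in>power_tuples A n. f j us \<in> A)"
proof -
  have map_nth_upt: "map (\<lambda>i. f ([0..<m] ! i) (h i)) [0..<m] = map (\<lambda>j. f j (h j)) [0..<m]" for h
    by (rule map_cong) auto
  have "preserves n f ([0..<m], X) \<longleftrightarrow>
      (\<forall>xs\<in>power_tuples X n. map (\<lambda>j. f j (map (\<lambda>x. x ! j) xs)) [0..<m] \<in> X)"
    by (simp add: preserves_def map_nth_upt)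
  moreover have "(\<forall>Q\<in>with_family m \<U> ([0..<m], X). preserves n f Q) \<longleftrightarrow>
      preserves n f ([0..<m], X) \<and> (\<forall>j<m. \<forall>A\<in>\<U> j. preserves n f ([j], (\<lambda>x. [x]) ` A))"
    by (auto simp: with_family_def)
  ultimately show ?thesis
    by (simp add: polymorphism_def iia_aggregator_def preserves_unary)
qed

text \<open>The only list of length \<open>n\<close> over a singleton is the constant one.\<close>

lemma idempotent_iff:
  "idempotent m X n f \<longleftrightarrow>
     (\<forall>j<m. \<forall>A\<in>(\<lambda>v. {v}) ` pr X j. \<forall>us\<in>power_tuples A n. f j us \<in> A)"
proof -
  have "power_tuples {u} n = {replicate n u}" for u :: 'a
    by (auto simp: power_tuples_def intro!: replicate_eqI)
  then show ?thesis by (simp add: idempotent_def)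
qed

text \<open>For the converse, closure is applied to the subset \<open>set us\<close> of the
  range.\<close>

lemma supportive_iff:
  "supportive m X n f \<longleftrightarrow>
     (\<forall>j<m. \<forall>A\<in>Pow (pr X j). \<forall>us\<in>power_tuples A n. f j us \<in> A)"
proof
  assume "supportive m X n f"
  then show "\<forall>j<m. \<forall>A\<in>Pow (pr X j). \<forall>us\<in>power_tuples A n. f j us \<in> A"
    by (fastforce simp: supportive_def power_tuples_def)
next
  assume *: "\<forall>j<m. \<forall>A\<in>Pow (pr X j). \<forall>us\<in>power_tuples A n. f j us \<in> A"
  show "supportive m X n f"
    unfolding supportive_def
  proof (intro allI impI ballI)
    fix j us assume "j < m" "us \<in> power_tuples (pr X j) n"
    moreover from this have "us \<in> power_tuples (set us) n" "set us \<in> Pow (pr X j)"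
      by (auto simp: power_tuples_def)
    ultimately show "f j us \<in> set us" using * by blast
  qed
qed

text \<open>On columns inside the ranges, which well-typedness guarantees, a dictatorship picks out
  one of the given rows.\<close>

lemma dictatorship_preserves:
  assumes dict: "dictatorship m X n f" and typed: "well_typed m (pr X) (\<sigma>, R)"
  shows "preserves n f (\<sigma>, R)"
  unfolding preserves_def split
proof
  fix rs assume rs: "rs \<in> power_tuples R n"
  obtain k where k: "k < n" "\<And>j us. j < m \<Longrightarrow> us \<in> power_tuples (pr X j) n \<Longrightarrow> f j us = us ! k"
    using dict by (auto simp: dictatorship_def)
  have mem: "rs ! k \<in> R" using rs k(1) by (rule power_tuples_nth_mem)
  have "length rs = n" using rs by (simp add: power_tuples_def)
  have "map (\<lambda>i. f (\<sigma> ! i) (map (\<lambda>r. r ! i) rs)) [0..<length \<sigma>] = rs ! k"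
  proof (rule nth_equalityI)
    show "length (map (\<lambda>i. f (\<sigma> ! i) (map (\<lambda>r. r ! i) rs)) [0..<length \<sigma>]) = length (rs ! k)"
      using mem typed by (auto simp: well_typed_def typed_tuples_def)
  next
    fix i assume "i < length (map (\<lambda>i. f (\<sigma> ! i) (map (\<lambda>r. r ! i) rs)) [0..<length \<sigma>])"
    then have i: "i < length \<sigma>" by simp
    have "\<sigma> ! i < m" using typed i nth_mem by (fastforce simp: well_typed_def)
    moreover have "map (\<lambda>r. r ! i) rs \<in> power_tuples (pr X (\<sigma> ! i)) n"
      using typed i by (intro map_power_tuples[OF rs]) (auto simp: well_typed_def typed_tuples_def)
    ultimately show
      "map (\<lambda>i. f (\<sigma> ! i) (map (\<lambda>r. r ! i) rs)) [0..<length \<sigma>] ! i = rs ! k ! i"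
      using i k \<open>length rs = n\<close> by simp
  qed
  with mem show "map (\<lambda>i. f (\<sigma> ! i) (map (\<lambda>r. r ! i) rs)) [0..<length \<sigma>] \<in> R" by simp
qed

text \<open>On an impossibility domain, polymorphisms of arity at least two are dictatorships, so
  every nonempty well-typed relation is expressible. Conversely, expressibility makes every
  aggregator with \<open>P\<close> preserve the relations required by
  \<open>dictator_if_preserves\<close>.\<close>

lemma impossibility_domain_iff_expressible:
  fixes X :: "'a list set"
  assumes X: "X \<subseteq> power_tuples D m" and nondeg: "nondegenerate m X"
    and \<U>: "\<And>j. j < m \<Longrightarrow> \<U> j \<subseteq> Pow (pr X j)"
    and P: "\<And>n f. P m X n f \<longleftrightarrow> (\<forall>j<m. \<forall>A\<in>\<U> j. \<forall>us\<in>power_tuples A n. f j us \<in> A)"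
  defines "\<Gamma> \<equiv> with_family m \<U> ([0..<m], X)"
  shows "impossibility_domain P m X \<longleftrightarrow>
    (\<forall>k<m. \<forall>l<m. \<forall>u\<in>pr X k. \<forall>v\<in>pr X l. expressible m (pr X) \<Gamma> (excl_rel (pr X) k l u v)) \<and>
    (\<forall>j<m. card (pr X j) = 2 \<longrightarrow> expressible m (pr X) \<Gamma> (NAE_rel (pr X) j))"
    (is "?imp \<longleftrightarrow> ?expr")
proof
  have poly_iff: "polymorphism m (pr X) \<Gamma> n f \<longleftrightarrow> iia_aggregator m X n f \<and> P m X n f" for n f
    by (simp add: \<Gamma>_def polymorphism_with_family_iff P)
  have card: "card (pr X j) > 1" if "j < m" for j
    using nondeg that by (simp add: nondegenerate_def)
  have finpr: "finite (pr X j)" if "j < m" for j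
    using card[OF that] card_ge_0_finite[of "pr X j"] by simp
  {
    assume imp: ?imp
    \<comment> \<open>Finiteness of \<open>\<Gamma>\<close> keeps the list of atoms in the indicator
      gadget finite.\<close>
    have "finite (\<Union>j<m. (\<lambda>A. ([j], (\<lambda>x. [x]) ` A)) ` \<U> j)"

      using finite_subset[OF \<U>] finpr by simp    moreover have "\<Gamma> = insert ([0..<m], X) (\<Union>j<m. (\<lambda>A. ([j], (\<lambda>x. [x]) ` A)) ` \<U> j)"
      by (auto simp: \<Gamma>_def with_family_def)
    ultimately have fin\<Gamma>: "finite \<Gamma>" by simp
    have "well_typed m (pr X) ([0..<m], X)"
      using X by (auto simp: well_typed_def typed_tuples_def power_tuples_def pr_def)
    then have typed\<Gamma>: "well_typed m (pr X) Q" if "Q \<in> \<Gamma>" for Q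
      using that \<U> by (fastforce simp: \<Gamma>_def with_family_def well_typed_def typed_tuples_def)
    have expr: "expressible m (pr X) \<Gamma> (\<sigma>, R)"
      if typed: "well_typed m (pr X) (\<sigma>, R)" and ne: "R \<noteq> {}" for \<sigma> R
    proof -
      have "finite R"
      proof (rule finite_subset)
        show "R \<subseteq> typed_tuples (pr X) \<sigma>" "finite (typed_tuples (pr X) \<sigma>)"
          using typed by (auto simp: well_typed_def intro!: finite_typed_tuples finpr)
      qed
      then obtain rs where rs: "set rs = R" using finite_list by blast
      \<comment> \<open>The repetition guarantees arity at least two.\<close>
      define qs where "qs = rs @ rs"
      have R: "R = set qs" using rs by (simp add: qs_def)
      have "length rs \<noteq> 0" using rs ne by auto
      then have len: "length qs \<ge> 2" unfolding qs_def length_append by linarith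
      show ?thesis
        unfolding R
      proof (rule expressible_if_preserved[OF finpr fin\<Gamma> typed\<Gamma>])
        show "well_typed m (pr X) (\<sigma>, set qs)" using typed R by simp
      next
        fix f assume "polymorphism m (pr X) \<Gamma> (length qs) f"
        then have "dictatorship m X (length qs) f"
          using imp len by (auto simp: poly_iff impossibility_domain_def)
        then show "preserves (length qs) f (\<sigma>, set qs)"
          using dictatorship_preserves typed R by blast
      qed
    qed
    have other: "\<exists>x\<in>pr X j. x \<noteq> u" if "j < m" for j u
      using card_gt_1_other[OF card[OF that]] .
    have "expressible m (pr X) \<Gamma> (excl_rel (pr X) k l u v)"
      if "k < m" "l < m" "u \<in> pr X k" "v \<in> pr X l" for k l u v
    proof -
      \<comment> \<open>The pair of \<open>u'\<close> and \<open>v\<close> survives the exclusion,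
        so the relation is nonempty.\<close>
      obtain u' where "u' \<in> pr X k" "u' \<noteq> u" using other \<open>k < m\<close> by blast
      then have "snd (excl_rel (pr X) k l u v) \<noteq> {}"
        using that by (auto simp: excl_rel_def)
      moreover have "well_typed m (pr X) (excl_rel (pr X) k l u v)"
        using that by (auto simp: well_typed_def excl_rel_def typed_tuples_def less_Suc_eq)
      ultimately show ?thesis using expr by (metis prod.collapse)
    qed
    moreover have "expressible m (pr X) \<Gamma> (NAE_rel (pr X) j)" if j: "j < m" for j
    proof -
      obtain u where u: "u \<in> pr X j" using other j by blast
      obtain v where v: "v \<in> pr X j" "v \<noteq> u" using other j by blast
      have "[u, u, v] \<in> snd (NAE_rel (pr X) j)"
        using u v by (simp add: NAE_rel_def)
      moreover have "well_typed m (pr X) (NAE_rel (pr X) j)"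
        using j by (auto simp: well_typed_def NAE_rel_def typed_tuples_def less_Suc_eq)
      ultimately show ?thesis using expr by (metis prod.collapse empty_iff)
    qed
    ultimately show ?expr by blast
  next
    assume expr: ?expr
    have "dictatorship m X n f"
      if n: "n \<ge> 2" and f: "iia_aggregator m X n f" "P m X n f" for n f
    proof -
      have poly: "polymorphism m (pr X) \<Gamma> n f" using f by (simp add: poly_iff)
      show ?thesis
        unfolding dictatorship_def
      proof (rule dictator_if_preserves)
        show "f j us \<in> pr X j" if "j < m" "us \<in> power_tuples (pr X j) n" for j us
          using f that by (simp add: iia_aggregator_def)
      qed (use n card expr expressible_imp_preserves[OF poly] in auto)
    qed
    then show ?imp by (auto simp: impossibility_domain_def)
  }
qed

theorem theorem10:
  fixes D :: "'a set" and X :: "'a list set" and m :: nat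
  assumes "finite D"
    and "X \<subseteq> power_tuples D m"
    and "nondegenerate m X"
  shows
    "(impossibility_domain idempotent m X \<longleftrightarrow>
       (\<forall>k<m. \<forall>l<m. \<forall>u\<in>pr X k. \<forall>v\<in>pr X l.
          expressible m (pr X) (with_assignments m (pr X) ([0..<m], X))
            (excl_rel (pr X) k l u v)) \<and>
       (\<forall>j<m. card (pr X j) = 2 \<longrightarrow>
          expressible m (pr X) (with_assignments m (pr X) ([0..<m], X)) (NAE_rel (pr X) j)))
     \<and>
     (impossibility_domain supportive m X \<longleftrightarrow>
       (\<forall>k<m. \<forall>l<m. \<forall>u\<in>pr X k. \<forall>v\<in>pr X l.
          expressible m (pr X) (with_unaries m (pr X) ([0..<m], X))
            (excl_rel (pr X) k l u v)) \<and>
       (\<forall>j<m. card (pr X j) = 2 \<longrightarrow>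
          expressible m (pr X) (with_unaries m (pr X) ([0..<m], X)) (NAE_rel (pr X) j)))"
proof
  note iff = impossibility_domain_iff_expressible[OF assms(2,3)]
  show "impossibility_domain idempotent m X \<longleftrightarrow>
       (\<forall>k<m. \<forall>l<m. \<forall>u\<in>pr X k. \<forall>v\<in>pr X l.
          expressible m (pr X) (with_assignments m (pr X) ([0..<m], X))
            (excl_rel (pr X) k l u v)) \<and>
       (\<forall>j<m. card (pr X j) = 2 \<longrightarrow>
          expressible m (pr X) (with_assignments m (pr X) ([0..<m], X)) (NAE_rel (pr X) j))"
    unfolding with_assignments_eq by (rule iff) (auto simp: idempotent_iff)
  show "impossibility_domain supportive m X \<longleftrightarrow>
       (\<forall>k<m. \<forall>l<m. \<forall>u\<in>pr X k. \<forall>v\<in>pr X l.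
          expressible m (pr X) (with_unaries m (pr X) ([0..<m], X))
            (excl_rel (pr X) k l u v)) \<and>
       (\<forall>j<m. card (pr X j) = 2 \<longrightarrow>
          expressible m (pr X) (with_unaries m (pr X) ([0..<m], X)) (NAE_rel (pr X) j))"
    unfolding with_unaries_eq by (rule iff) (simp_all add: supportive_iff)
qed

end
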